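(* Let $\lambda\neq0$ be a complex number, $u\in\mathbb{C}$ with $u\neq1$, and $r\in\mathbb{N}$. For every integer $m\ge0$, \[ H^{(r)}_m(x|u)=\sum_{n=0}^{m}h^{(r)}_{n,\lambda}(x|u)\,\lambda^{m-n}S_2(m,n). \]
   Context: For $\lambda\neq0$, $(x|\lambda)_0=1$ and $(x|\lambda)_n=x(x-\lambda)\cdots(x-(n-1)\lambda)$; $(1+\lambda t)^{x/\lambda}$ denotes the formal power series $\sum_{n\ge0}(x|\lambda)_n t^n/n!$. The degenerate Frobenius–Euler polynomials of order $r$ are defined by \[ \left(\frac{1-u}{(1+\lambda t)^{1/\lambda}-u}\right)^r(1+\lambda t)^{x/\lambda}=\sum_{n=0}^\infty h^{(r)}_{n,\lambda}(x|u)\frac{t^n}{n!}, \] and the higher-order Frobenius–Euler polynomials by \[ \left(\frac{1-u}{e^t-u}\right)^r e^{xt}=\sum_{n=0}^\infty H^{(r)}_n(x|u)\frac{t^n}{n!}. \] $S_2(m,n)$ are the Stirling numbers of the second kind, defined by $x^m=\sum_{n=0}^m S_2(m,n)(x)_n$, where $(x)_0=1$, $(x)_n=x(x-1)\cdots(x-n+1)$. *)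

theory Defs
  imports
    Complex_Main
    "HOL-Computational_Algebra.Formal_Power_Series"
    "HOL-Combinatorics.Stirling"
begin

text \<open>The generalized falling factorial \<open>(x|lam)\<^sub>n = x (x - lam) \<dots> (x - (n-1) lam)\<close>;
  for \<open>lam = 1\<close> it is the ordinary falling factorial \<open>(x)\<^sub>n\<close>.\<close>

definition deg_ffact :: "complex \<Rightarrow> complex \<Rightarrow> nat \<Rightarrow> complex" where
  "deg_ffact x lam n = (\<Prod>i<n. x - of_nat i * lam)"

text \<open>The formal power series \<open>(1 + lam t)\<^bsup>x/lam\<^esup>\<close>.\<close>

definition deg_exp :: "complex \<Rightarrow> complex \<Rightarrow> complex fps" where
  "deg_exp lam x = Abs_fps (\<lambda>n. deg_ffact x lam n / fact n)"

text \<open>The polynomials are given by their values at a complex argument \<open>x\<close>. The constant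
  coefficient of the denominators below is \<open>1 - u\<close>, so for \<open>u \<noteq> 1\<close> they are units and
  \<open>/\<close> is genuine division of formal power series.\<close>

definition deg_frobenius_euler_gf :: "nat \<Rightarrow> complex \<Rightarrow> complex \<Rightarrow> complex \<Rightarrow> complex fps" where
  "deg_frobenius_euler_gf r lam x u =
     (fps_const (1 - u) / (deg_exp lam 1 - fps_const u)) ^ r * deg_exp lam x"

definition deg_frobenius_euler :: "nat \<Rightarrow> complex \<Rightarrow> nat \<Rightarrow> complex \<Rightarrow> complex \<Rightarrow> complex" where
  "deg_frobenius_euler r lam n x u = fact n * fps_nth (deg_frobenius_euler_gf r lam x u) n"

definition frobenius_euler_gf :: "nat \<Rightarrow> complex \<Rightarrow> complex \<Rightarrow> complex fps" where
  "frobenius_euler_gf r x u =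
     (fps_const (1 - u) / (fps_exp 1 - fps_const u)) ^ r * fps_exp x"

definition frobenius_euler :: "nat \<Rightarrow> nat \<Rightarrow> complex \<Rightarrow> complex \<Rightarrow> complex" where
  "frobenius_euler r n x u = fact n * fps_nth (frobenius_euler_gf r x u) n"

lemma deg_frobenius_euler_gf_eq:
  "deg_frobenius_euler_gf r lam x u = Abs_fps (\<lambda>n. deg_frobenius_euler r lam n x u / fact n)"
  by (rule fps_ext) (simp add: deg_frobenius_euler_def)

lemma frobenius_euler_gf_eq:
  "frobenius_euler_gf r x u = Abs_fps (\<lambda>n. frobenius_euler r n x u / fact n)"
  by (rule fps_ext) (simp add: frobenius_euler_def)

lemma deg_frobenius_euler_denominator_nth_0:
  "fps_nth (deg_exp lam 1 - fps_const u) 0 = 1 - u"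
  by (simp add: deg_exp_def deg_ffact_def)

lemma frobenius_euler_denominator_nth_0:
  "fps_nth (fps_exp (1::complex) - fps_const u) 0 = 1 - u"
  by simp

text \<open>The recursively defined library Stirling numbers satisfy the defining expansion
  of \<open>x\<^sup>m\<close> in falling factorials.\<close>

lemma power_eq_sum_Stirling:
  "x ^ m = (\<Sum>n=0..m. of_nat (Stirling m n) * deg_ffact x 1 n)"
proof (induction m)
  case 0
  show ?case by (simp add: deg_ffact_def)
next
  case (Suc m)
  have step: "x * deg_ffact x 1 n = deg_ffact x 1 (Suc n) + of_nat n * deg_ffact x 1 n" for n
    by (simp add: deg_ffact_def algebra_simps)
  have shift: "(\<Sum>n=0..m. of_nat (n * Stirling m n) * deg_ffact x 1 n) =
      (\<Sum>n=0..m. of_nat (Suc n * Stirling m (Suc n)) * deg_ffact x 1 (Suc n))"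
  proof -
    have "(\<Sum>n=0..m. of_nat (n * Stirling m n) * deg_ffact x 1 n) =
        (\<Sum>n=0..Suc m. of_nat (n * Stirling m n) * deg_ffact x 1 n)"
      by simp
    also have "\<dots> = (\<Sum>n=0..m. of_nat (Suc n * Stirling m (Suc n)) * deg_ffact x 1 (Suc n))"
      by (subst sum.atLeast0_atMost_Suc_shift) (simp add: distrib_right)
    finally show ?thesis .
  qed
  have "x ^ Suc m = (\<Sum>n=0..m. of_nat (Stirling m n) * (x * deg_ffact x 1 n))"
    by (simp add: Suc.IH sum_distrib_left mult_ac)
  also have "\<dots> = (\<Sum>n=0..m. of_nat (Stirling m n) * deg_ffact x 1 (Suc n)) +
      (\<Sum>n=0..m. of_nat (n * Stirling m n) * deg_ffact x 1 n)"
    by (simp add: step sum.distrib distrib_left mult_ac)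
  also have "\<dots> = (\<Sum>n=0..m. of_nat (Stirling (Suc m) (Suc n)) * deg_ffact x 1 (Suc n))"
    unfolding shift sum.distrib [symmetric]
    by (intro sum.cong refl) (simp add: algebra_simps)
  also have "\<dots> = (\<Sum>n=0..Suc m. of_nat (Stirling (Suc m) n) * deg_ffact x 1 n)"
    by (subst sum.atLeast0_atMost_Suc_shift) simp
  finally show ?case .
qed

end

theory Submission
  imports Defs
begin

text \<open>Substituting \<open>g = (e\<^bsup>lam t\<^esup> - 1) / lam\<close> for \<open>t\<close> turns \<open>(1 + lam t)\<^bsup>x/lam\<^esup>\<close> into
  \<open>e\<^bsup>x t\<^esup>\<close>, hence the degenerate generating function into the classical one. The identity then
  is the comparison of coefficients, since \<open>g\<^sup>n / n!\<close> is the exponential generating function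
  of \<open>lam\<^bsup>m-n\<^esup> S\<^sub>2(m,n)\<close>.\<close>

definition scaled_expm1 :: "complex \<Rightarrow> complex fps" where
  "scaled_expm1 lam = fps_const (inverse lam) * (fps_exp lam - 1)"

lemma scaled_expm1_nth_0 [simp]: "fps_nth (scaled_expm1 lam) 0 = 0"
  by (simp add: scaled_expm1_def)

text \<open>Both sides equal \<open>fps_exp lam\<close>. Writing the derivative through the series
  itself is what yields a recurrence for the coefficients of its powers.\<close>

lemma fps_deriv_scaled_expm1:
  assumes "lam \<noteq> 0"
  shows "fps_deriv (scaled_expm1 lam) = 1 + fps_const lam * scaled_expm1 lam"
proof -
  have "fps_const lam * scaled_expm1 lam = (fps_const lam * fps_const (inverse lam)) * (fps_exp lam - 1)"
    by (simp only: scaled_expm1_def mult.assoc)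
  also have "\<dots> = fps_exp lam - 1"
    using assms by simp
  finally have R: "fps_const lam * scaled_expm1 lam = fps_exp lam - 1" .
  have "fps_deriv (scaled_expm1 lam) = (fps_const (inverse lam) * fps_const lam) * fps_exp lam"
    by (simp only: scaled_expm1_def fps_deriv_mult_const_left fps_deriv_sub fps_exp_deriv
        fps_deriv_1 mult.assoc diff_zero)
  also have "\<dots> = fps_exp lam"
    using assms by simp
  finally show ?thesis
    by (simp add: R)
qed

text \<open>With g the series, (g^(k+1))' = (k+1) (g^k + lam g^(k+1)); comparing coefficients gives
  the recurrence S(m+1,k+1) = S(m,k) + (k+1) S(m,k+1), weighted by factorials and powers of
  \<open>lam\<close>. For n > m both sides vanish.\<close>

lemma scaled_expm1_power_nth:
  assumes "lam \<noteq> 0"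
  shows "fact m * fps_nth (scaled_expm1 lam ^ n) m =
    fact n * lam ^ (m - n) * of_nat (Stirling m n)"
proof (induction m arbitrary: n)
  case 0
  show ?case by (cases n) simp_all
next
  case (Suc m)
  show ?case
  proof (cases n)
    case 0
    then show ?thesis by simp
  next
    case (Suc k)
    let ?g = "scaled_expm1 lam"
    have "fps_deriv (?g ^ Suc k) = fps_const (of_nat (Suc k)) * (?g ^ k + fps_const lam * ?g ^ Suc k)"
      by (simp only: fps_deriv_power fps_deriv_scaled_expm1 [OF assms])
        (simp add: algebra_simps)
    from arg_cong [OF this, of "\<lambda>f. fps_nth f m"]
    have "of_nat (Suc m) * fps_nth (?g ^ Suc k) (Suc m) =
        of_nat (Suc k) * (fps_nth (?g ^ k) m + lam * fps_nth (?g ^ Suc k) m)"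
      by (simp only: fps_deriv_nth fps_mult_left_const_nth fps_add_nth Suc_eq_plus1)
    then have "fact (Suc m) * fps_nth (?g ^ Suc k) (Suc m) =
        of_nat (Suc k) * (fact m * fps_nth (?g ^ k) m + lam * (fact m * fps_nth (?g ^ Suc k) m))"
      by (simp only: fact_Suc of_nat_mult) (simp only: algebra_simps)
    also have "\<dots> = of_nat (Suc k) * (fact k * lam ^ (m - k) * of_nat (Stirling m k) +
        fact (Suc k) * (lam * lam ^ (m - Suc k) * of_nat (Stirling m (Suc k))))"
      by (simp only: Suc.IH) (simp only: algebra_simps)
    \<comment> \<open>For m \<le> k the truncated exponents are both 0 and the powers differ by a
      factor \<open>lam\<close>, but then \<open>Stirling m (Suc k)\<close> is 0.\<close>
    also have "lam * lam ^ (m - Suc k) * of_nat (Stirling m (Suc k)) =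
        lam ^ (m - k) * of_nat (Stirling m (Suc k))"
      by (cases "Suc k \<le> m") (simp_all add: Suc_diff_Suc flip: power_Suc)
    also have "of_nat (Suc k) * (fact k * lam ^ (m - k) * of_nat (Stirling m k) +
        fact (Suc k) * (lam ^ (m - k) * of_nat (Stirling m (Suc k)))) =
        fact (Suc k) * lam ^ (Suc m - Suc k) * of_nat (Stirling (Suc m) (Suc k))"
      by (simp add: algebra_simps)
    finally show ?thesis
      unfolding Suc .
  qed
qed

lemma fps_compose_scaled_expm1_nth:
  assumes "lam \<noteq> 0"
  shows "fact m * fps_nth (f oo scaled_expm1 lam) m =
    (\<Sum>n=0..m. fact n * fps_nth f n * lam ^ (m - n) * of_nat (Stirling m n))"
proof -
  have "fact m * fps_nth (f oo scaled_expm1 lam) m =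
      (\<Sum>n=0..m. fps_nth f n * (fact m * fps_nth (scaled_expm1 lam ^ n) m))"
    by (simp add: fps_compose_nth sum_distrib_left mult_ac)
  then show ?thesis
    by (simp add: scaled_expm1_power_nth [OF assms] mult_ac)
qed

text \<open>Taking \<open>lam\<close> out of each factor leaves an ordinary falling factorial, to
  which \<open>power_eq_sum_Stirling\<close> applies.\<close>

lemma deg_ffact_scale:
  assumes "lam \<noteq> 0"
  shows "deg_ffact x lam n = lam ^ n * deg_ffact (x / lam) 1 n"
proof -
  have "lam ^ n * deg_ffact (x / lam) 1 n = (\<Prod>i<n. lam * (x / lam - of_nat i))"
    by (simp add: deg_ffact_def prod.distrib)
  also have "\<dots> = deg_ffact x lam n"
    using assms by (simp add: deg_ffact_def right_diff_distrib mult.commute)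
  finally show ?thesis ..
qed

lemma deg_exp_compose_scaled_expm1:
  assumes "lam \<noteq> 0"
  shows "deg_exp lam x oo scaled_expm1 lam = fps_exp x"
proof (rule fps_ext)
  fix m
  have "fact m * fps_nth (deg_exp lam x oo scaled_expm1 lam) m =
      (\<Sum>n=0..m. lam ^ m * (of_nat (Stirling m n) * deg_ffact (x / lam) 1 n))"
    unfolding fps_compose_scaled_expm1_nth [OF assms]
  proof (intro sum.cong refl)
    fix n assume "n \<in> {0..m}"
    then have "lam ^ m = lam ^ n * lam ^ (m - n)"
      by (simp flip: power_add)
    then show "fact n * fps_nth (deg_exp lam x) n * lam ^ (m - n) * of_nat (Stirling m n) =
        lam ^ m * (of_nat (Stirling m n) * deg_ffact (x / lam) 1 n)"
      by (simp add: deg_exp_def deg_ffact_scale [OF assms])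
  qed
  \<comment> \<open>The sum is the Stirling expansion of the m-th power of
    \<open>x / lam\<close>.\<close>
  also have "\<dots> = lam ^ m * (x / lam) ^ m"
    by (simp add: power_eq_sum_Stirling sum_distrib_left)
  also have "\<dots> = x ^ m"
    using assms by (simp add: power_divide)
  finally show "fps_nth (deg_exp lam x oo scaled_expm1 lam) m = fps_nth (fps_exp x) m"
    by (simp add: field_simps)
qed

text \<open>Composition with a series without constant term respects sums, products and inverses of
  units. The denominator is a unit because u \<noteq> 1, so the substitution acts on each
  \<open>deg_exp\<close> separately.\<close>

lemma deg_frobenius_euler_gf_compose:
  assumes "lam \<noteq> 0" and "u \<noteq> 1"
  shows "deg_frobenius_euler_gf r lam x u oo scaled_expm1 lam = frobenius_euler_gf r x u"
proof -
  have "fps_nth (deg_exp lam 1 - fps_const u) 0 \<noteq> 0"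
    using assms(2) by (simp only: deg_frobenius_euler_denominator_nth_0) simp
  then show ?thesis
    using assms(2)
    by (simp add: deg_frobenius_euler_gf_def frobenius_euler_gf_def fps_divide_unit
        fps_compose_mult_distrib fps_compose_power [symmetric] fps_inverse_compose
        fps_compose_sub_distrib deg_exp_compose_scaled_expm1 [OF assms(1)])
qed

theorem theorem5:
  fixes lam u x :: complex and r m :: nat
  assumes "lam \<noteq> 0" and "u \<noteq> 1"
  shows "frobenius_euler r m x u =
    (\<Sum>n=0..m. deg_frobenius_euler r lam n x u * lam ^ (m - n) * of_nat (Stirling m n))"
  unfolding frobenius_euler_def deg_frobenius_euler_def
  by (simp only: deg_frobenius_euler_gf_compose [OF assms, symmetric]
      fps_compose_scaled_expm1_nth [OF assms(1)])

end
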